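(* Let $G$ be a torus with Lie algebra $\mathfrak g$ and integral lattice $\mathbb Z_G\subset\mathfrak g$. Let $u_1,\dots,u_N\in\mathbb Z_G$ be primitive vectors spanning $\mathfrak g$ over $\mathbb R$, let $\lambda_1,\dots,\lambda_N\in\mathbb R$, and let $P=\{\eta\in\mathfrak g^*\mid \langle\eta,u_j\rangle-\lambda_j\ge 0,\ 1\le j\le N\}$. Assume that $P$ has non-empty interior $\mathring P$, that the collection of inequalities defining $P$ is minimal (dropping any one of them gives a strictly bigger set), and that $P$ is compact. Let $R>0$ be sufficiently large that $\iota_\lambda(P)\subset\Delta_R$ and that $R-\sum_j(u_j-\lambda_j)>0$ on $\mathring P$. Let $M_P=(\mathbb CP^N,R\omega_{FS})/\!/_\nu K$ be the Kähler quotient with its $G$-action and moment map $\phi_P:M_P\to\mathfrak g^*$ described in the context. Then the Kähler form $\omega_P$ on $\mathring M_P:=\phi_P^{-1}(\mathring P)$ is $$\omega_P=\sqrt{-1}\,\partial\bar\partial\,\phi_P^*\Big(\sum_{j=1}^N\lambda_j\log(u_j-\lambda_j)-\Big(R+\sum_{j=1}^N\lambda_j\Big)\log\Big(R-\sum_{j=1}^N(u_j-\lambda_j)\Big)\Big),$$ where $u_j$ is regarded as the function $\eta\mapsto\langle\eta,u_j\rangle$ on $\mathfrak g^*$.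
   Context: Let $A:\mathbb R^N\to\mathfrak g$ be the linear map with $A(e_i)=u_i$ ($e_i$ the standard basis, $e_i^*$ the dual basis of $(\mathbb R^N)^*$). It maps $\mathbb Z^N$ into $\mathbb Z_G$ and induces a surjective homomorphism $\bar A:\mathbb T^N=\mathbb R^N/\mathbb Z^N\to\mathfrak g/\mathbb Z_G=G$. Let $K=\ker\bar A$, a compact abelian (possibly disconnected) group with Lie algebra $\mathfrak k=\ker A$, let $B:\mathfrak k\to\mathbb R^N$ be the inclusion, and let $A^*,B^*$ be the dual maps. Put $\lambda=\sum_i\lambda_ie_i^*$, $\nu=B^*(-\lambda)\in\mathfrak k^*$, and let $\iota_\lambda:\mathfrak g^*\to(\mathbb R^N)^*$, $\iota_\lambda(\ell)=-\lambda+A^*(\ell)$, an affine embedding with image $(B^* )^{-1}(\nu)$. Let $$\Delta_R=\{\ell\in(\mathbb R^N)^*\mid\langle\ell,e_j\rangle\ge0\text{ for all }j,\ \textstyle\sum_j\langle\ell,e_j\rangle\le R\}.$$ $\omega_{FS}$ is the Fubini–Study form, normalized so that on the chart $\{z_0=1\}$ one has $\omega_{FS}=\sqrt{-1}\,\partial\bar\partial\log(1+\sum_{j=1}^N|z_j|^2)$. $\mathbb T^N$ acts in the standard way on the coordinates $z_1,\dots,z_N$, with moment map for $R\omega_{FS}$ normalized as $\phi([z_0:\dots:z_N])=R\sum_{j=1}^N\frac{|z_j|^2}{\sum_{k=0}^N|z_k|^2}e_j^*$, whose image is $\Delta_R$ (this is the normalization in which the flat form $\sqrt{-1}\,\partial\bar\partial\|z\|^2$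 on $\mathbb C^N$ has moment map $\sum_j|z_j|^2e_j^*$). The $K$-moment map is $\phi_K=B^*\circ\phi$, and $M_P=(\mathbb CP^N,R\omega_{FS})/\!/_\nu K:=\phi_K^{-1}(\nu)/K$, with the action of $G=\mathbb T^N/K$. The restriction of $\phi$ to $\phi_K^{-1}(\nu)$ descends to $\bar\phi:M_P\to\iota_\lambda(\mathfrak g^* )$, and $\phi_P:=\iota_\lambda^{-1}\circ\bar\phi:M_P\to\mathfrak g^*$ is the moment map, with image $P$. On $\mathring M_P=\phi_P^{-1}(\mathring P)$, which is the quotient by the free $K$-action on $\phi_K^{-1}(\nu)\cap(\mathbb C^\times)^N$ (with $(\mathbb C^\times)^N\subset\mathbb CP^N$ the set where all homogeneous coordinates are nonzero), $\omega_P$ is the usual reduced Kähler form for the reduced complex structure. *)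

theory Defs
  imports "HOL-Analysis.Analysis" "HOL-Algebra.Coset"
begin

section \<open>Tori\<close>

text \<open>The Lie algebra of a torus is a finite-dimensional real vector space \<open>'g\<close> (class
  \<open>euclidean_space\<close>; its inner product is never used), the integral lattice is a full lattice
  in it and the torus is the quotient group. The dual space is \<open>'g \<Rightarrow>\<^sub>L real\<close>.\<close>

definition full_lattice :: "'g::euclidean_space set \<Rightarrow> bool" where
  "full_lattice Z \<longleftrightarrow>
     (\<exists>B. independent B \<and> span B = UNIV \<and>
          Z = {\<Sum>b\<in>B. of_int (c b) *\<^sub>R b | c :: 'g \<Rightarrow> int. True})"

definition primitive_vector :: "'g::real_vector set \<Rightarrow> 'g \<Rightarrow> bool" where
  "primitive_vector Z u \<longleftrightarrow>
     u \<in> Z \<and> u \<noteq> 0 \<and> (\<forall>v\<in>Z. \<forall>k::int. u = of_int k *\<^sub>R v \<longrightarrow> \<bar>k\<bar> = 1)"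

definition add_grp :: "'a::ab_group_add monoid" where
  "add_grp = \<lparr>carrier = UNIV, monoid.mult = (+), one = 0\<rparr>"

definition torus :: "'a::ab_group_add set \<Rightarrow> 'a set monoid" where
  "torus Z = add_grp Mod Z"

definition std_lattice :: "(real ^ 'n::finite) set" where
  "std_lattice = {t. \<forall>j. t $ j \<in> \<int>}"


section \<open>The group \<open>K\<close> and the linear data\<close>

definition map_A :: "('n::finite \<Rightarrow> 'g::euclidean_space) \<Rightarrow> (real ^ 'n) \<Rightarrow>\<^sub>L 'g" where
  "map_A u = Blinfun (\<lambda>t. \<Sum>j\<in>UNIV. (t $ j) *\<^sub>R u j)"

text \<open>The induced map sends the coset \<open>t + \<int>\<^sup>N\<close> to \<open>A t + Z\<close>.\<close>

definition map_Abar ::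
  "'g::euclidean_space set \<Rightarrow> ('n::finite \<Rightarrow> 'g) \<Rightarrow> (real ^ 'n) set \<Rightarrow> 'g set" where
  "map_Abar Z u T = (blinfun_apply (map_A u) ` T) <#>\<^bsub>add_grp\<^esub> Z"

definition group_K ::
  "'g::euclidean_space set \<Rightarrow> ('n::finite \<Rightarrow> 'g) \<Rightarrow> (real ^ 'n) set set" where
  "group_K Z u = kernel (torus std_lattice) (torus Z) (map_Abar Z u)"

definition lie_K :: "('n::finite \<Rightarrow> 'g::euclidean_space) \<Rightarrow> (real ^ 'n) set" where
  "lie_K u = {\<xi>. blinfun_apply (map_A u) \<xi> = 0}"

definition dual_A ::
  "('n::finite \<Rightarrow> 'g::euclidean_space) \<Rightarrow> ('g \<Rightarrow>\<^sub>L real) \<Rightarrow> ((real ^ 'n) \<Rightarrow>\<^sub>L real)" where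
  "dual_A u l = l o\<^sub>L map_A u"

text \<open>\<open>lie_K u\<close> is a subspace and not a type, so an element of its dual space is represented
  by a function that is \<open>undefined\<close> outside of it; the dual of the inclusion \<open>B\<close> restricts
  functionals.\<close>

definition dual_B ::
  "('n::finite \<Rightarrow> 'g::euclidean_space) \<Rightarrow> ((real ^ 'n) \<Rightarrow>\<^sub>L real) \<Rightarrow> (real ^ 'n \<Rightarrow> real)" where
  "dual_B u l = restrict (blinfun_apply l) (lie_K u)"

definition dual_basis :: "'n::finite \<Rightarrow> ((real ^ 'n) \<Rightarrow>\<^sub>L real)" where
  "dual_basis j = Blinfun (\<lambda>t. t $ j)"

definition lam_vec :: "('n::finite \<Rightarrow> real) \<Rightarrow> ((real ^ 'n) \<Rightarrow>\<^sub>L real)" where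
  "lam_vec lam = (\<Sum>j\<in>UNIV. lam j *\<^sub>R dual_basis j)"

definition nu :: "('n::finite \<Rightarrow> 'g::euclidean_space) \<Rightarrow> ('n \<Rightarrow> real) \<Rightarrow> (real ^ 'n \<Rightarrow> real)" where
  "nu u lam = dual_B u (- lam_vec lam)"

definition iota ::
  "('n::finite \<Rightarrow> 'g::euclidean_space) \<Rightarrow> ('n \<Rightarrow> real) \<Rightarrow> ('g \<Rightarrow>\<^sub>L real) \<Rightarrow> ((real ^ 'n) \<Rightarrow>\<^sub>L real)"
  where "iota u lam l = - lam_vec lam + dual_A u l"

definition simplex_R :: "real \<Rightarrow> ((real ^ 'n::finite) \<Rightarrow>\<^sub>L real) set" where
  "simplex_R R =
     {l :: (real ^ 'n) \<Rightarrow>\<^sub>L real. (\<forall>j. l (axis j 1) \<ge> 0) \<and> (\<Sum>j\<in>UNIV. l (axis j 1)) \<le> R}"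

definition polytope_P ::
  "('n::finite \<Rightarrow> 'g::euclidean_space) \<Rightarrow> ('n \<Rightarrow> real) \<Rightarrow> ('g \<Rightarrow>\<^sub>L real) set" where
  "polytope_P u lam = {\<eta> :: 'g \<Rightarrow>\<^sub>L real. \<forall>j. \<eta> (u j) - lam j \<ge> 0}"

definition minimal_inequalities ::
  "('n::finite \<Rightarrow> 'g::euclidean_space) \<Rightarrow> ('n \<Rightarrow> real) \<Rightarrow> bool" where
  "minimal_inequalities u lam \<longleftrightarrow>
     (\<forall>i. polytope_P u lam \<subset> {\<eta> :: 'g \<Rightarrow>\<^sub>L real. \<forall>j. j \<noteq> i \<longrightarrow> \<eta> (u j) - lam j \<ge> 0})"


section \<open>Projective space and its moment map\<close>

text \<open>The homogeneous coordinates \<open>z\<^sub>0, \<dots>, z\<^sub>N\<close> are indexed by \<open>'n option\<close>, with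
  \<open>None\<close> for the index 0. A point of projective space is a complex line through the origin.\<close>

definition line_through :: "complex ^ 'm::finite \<Rightarrow> (complex ^ 'm) set" where
  "line_through v = range (\<lambda>c. c *s v)"

definition proj_space :: "(complex ^ 'm::finite) set set" where
  "proj_space = line_through ` (- {0})"

definition affine_point :: "complex ^ 'n::finite \<Rightarrow> (complex ^ ('n option)) set" where
  "affine_point z = line_through (\<chi> i. case i of None \<Rightarrow> 1 | Some j \<Rightarrow> z $ j)"

definition torus_act :: "real ^ 'n::finite \<Rightarrow> complex ^ ('n option) \<Rightarrow> complex ^ ('n option)" where
  "torus_act t z =
     (\<chi> i. case i of None \<Rightarrow> z $ None | Some j \<Rightarrow> cis (2 * pi * t $ j) * z $ Some j)"

definition moment_hom :: "real \<Rightarrow> complex ^ ('n::finite option) \<Rightarrow> ((real ^ 'n) \<Rightarrow>\<^sub>L real)" where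
  "moment_hom R z =
     R *\<^sub>R (\<Sum>j\<in>UNIV. ((cmod (z $ Some j))\<^sup>2 / (\<Sum>k\<in>UNIV. (cmod (z $ k))\<^sup>2)) *\<^sub>R dual_basis j)"

definition moment :: "real \<Rightarrow> (complex ^ ('n::finite option)) set \<Rightarrow> ((real ^ 'n) \<Rightarrow>\<^sub>L real)" where
  "moment R p = the_elem (moment_hom R ` (p - {0}))"

definition moment_K ::
  "('n::finite \<Rightarrow> 'g::euclidean_space) \<Rightarrow> real \<Rightarrow> (complex ^ ('n option)) set \<Rightarrow> (real ^ 'n \<Rightarrow> real)"
  where "moment_K u R p = dual_B u (moment R p)"


section \<open>The reduced space\<close>

definition level_set ::
  "('n::finite \<Rightarrow> 'g::euclidean_space) \<Rightarrow> ('n \<Rightarrow> real) \<Rightarrow> real \<Rightarrow> (complex ^ ('n option)) set set"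
  where "level_set u lam R = {p \<in> proj_space. moment_K u R p = nu u lam}"

definition orbit_K ::
  "'g::euclidean_space set \<Rightarrow> ('n::finite \<Rightarrow> 'g) \<Rightarrow> (complex ^ ('n option)) set
     \<Rightarrow> (complex ^ ('n option)) set set" where
  "orbit_K Z u p = {torus_act t ` p | t T. T \<in> group_K Z u \<and> t \<in> T}"

definition reduced_space ::
  "'g::euclidean_space set \<Rightarrow> ('n::finite \<Rightarrow> 'g) \<Rightarrow> ('n \<Rightarrow> real) \<Rightarrow> real
     \<Rightarrow> (complex ^ ('n option)) set set set" where
  "reduced_space Z u lam R = orbit_K Z u ` level_set u lam R"

definition moment_P ::
  "('n::finite \<Rightarrow> 'g::euclidean_space) \<Rightarrow> ('n \<Rightarrow> real) \<Rightarrow> real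
     \<Rightarrow> (complex ^ ('n option)) set set \<Rightarrow> ('g \<Rightarrow>\<^sub>L real)" where
  "moment_P u lam R m = inv_into UNIV (iota u lam) (the_elem (moment R ` m))"

definition reduced_interior ::
  "'g::euclidean_space set \<Rightarrow> ('n::finite \<Rightarrow> 'g) \<Rightarrow> ('n \<Rightarrow> real) \<Rightarrow> real
     \<Rightarrow> (complex ^ ('n option)) set set set" where
  "reduced_interior Z u lam R =
     {m \<in> reduced_space Z u lam R. moment_P u lam R m \<in> interior (polytope_P u lam)}"


section \<open>Smooth maps and the operator \<open>\<i> \<partial> \<partial>bar\<close>\<close>

fun diff_order_on ::
  "nat \<Rightarrow> 'a::real_normed_vector set \<Rightarrow> ('a \<Rightarrow> 'b::real_normed_vector) \<Rightarrow> bool" where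
  "diff_order_on 0 S f \<longleftrightarrow> continuous_on S f"
| "diff_order_on (Suc n) S f \<longleftrightarrow>
     (\<forall>x\<in>S. f differentiable (at x)) \<and>
     (\<forall>v. diff_order_on n S (\<lambda>x. frechet_derivative f (at x) v))"

definition smooth_map_on ::
  "'a::real_normed_vector set \<Rightarrow> ('a \<Rightarrow> 'b::real_normed_vector) \<Rightarrow> bool" where
  "smooth_map_on S f \<longleftrightarrow> (\<forall>n. diff_order_on n S f)"

definition d_z :: "'m::finite \<Rightarrow> (complex ^ 'm \<Rightarrow> complex) \<Rightarrow> complex ^ 'm \<Rightarrow> complex" where
  "d_z j f x = (frechet_derivative f (at x) (axis j 1)
                  - \<i> * frechet_derivative f (at x) (axis j \<i>)) / 2"

definition d_zbar :: "'m::finite \<Rightarrow> (complex ^ 'm \<Rightarrow> complex) \<Rightarrow> complex ^ 'm \<Rightarrow> complex" where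
  "d_zbar j f x = (frechet_derivative f (at x) (axis j 1)
                     + \<i> * frechet_derivative f (at x) (axis j \<i>)) / 2"

text \<open>The 2-form \<open>\<i> \<Sum> (\<partial>\<^sup>2f / \<partial>z\<^sub>j \<partial>zbar\<^sub>k) dz\<^sub>j \<and> dzbar\<^sub>k\<close> at \<open>x\<close>, evaluated on the tangent
  vectors \<open>v\<close> and \<open>w\<close>, with
  \<open>(\<alpha> \<and> \<beta>)(v, w) = \<alpha>(v) \<beta>(w) - \<alpha>(w) \<beta>(v)\<close>.\<close>

definition i_ddbar ::
  "(complex ^ 'm::finite \<Rightarrow> real) \<Rightarrow> complex ^ 'm \<Rightarrow> complex ^ 'm \<Rightarrow> complex ^ 'm \<Rightarrow> complex" where
  "i_ddbar f x v w =
     \<i> * (\<Sum>j\<in>UNIV. \<Sum>k\<in>UNIV. d_z j (d_zbar k (\<lambda>y. complex_of_real (f y))) x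
             * (v $ j * cnj (w $ k) - w $ j * cnj (v $ k)))"

text \<open>The Fubini--Study form in the affine chart \<open>z\<^sub>0 = 1\<close>. This chart contains the
  part of the level set lying over the interior of the polytope, where all homogeneous
  coordinates are nonzero.\<close>

definition fubini_study ::
  "complex ^ 'n::finite \<Rightarrow> complex ^ 'n \<Rightarrow> complex ^ 'n \<Rightarrow> complex" where
  "fubini_study = i_ddbar (\<lambda>z. ln (1 + (\<Sum>j\<in>UNIV. (cmod (z $ j))\<^sup>2)))"

definition fs_metric :: "complex ^ 'n::finite \<Rightarrow> complex ^ 'n \<Rightarrow> complex ^ 'n \<Rightarrow> complex" where
  "fs_metric z v w = fubini_study z v (\<i> *s w)"


section \<open>The reduced complex structure and the reduced form\<close>

text \<open>Everything is written in the affine chart \<open>z\<^sub>0 = 1\<close>. The tangent space of the quotient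
  at the orbit of \<open>z\<close> is \<open>level_tangent z / orbit_tangent z\<close>. It is represented by the
  orthogonal complement \<open>horizontal z\<close> of \<open>orbit_tangent z\<close> in \<open>level_tangent z\<close>,
  which is stable under multiplication by \<open>\<i>\<close>; this multiplication is the reduced complex
  structure.\<close>

definition orbit_tangent ::
  "('n::finite \<Rightarrow> 'g::euclidean_space) \<Rightarrow> complex ^ 'n \<Rightarrow> (complex ^ 'n) set" where
  "orbit_tangent u z =
     (\<lambda>\<xi>. \<chi> j. 2 * complex_of_real pi * \<i> * complex_of_real (\<xi> $ j) * z $ j) ` lie_K u"

definition level_tangent ::
  "('n::finite \<Rightarrow> 'g::euclidean_space) \<Rightarrow> real \<Rightarrow> complex ^ 'n \<Rightarrow> (complex ^ 'n) set" where
  "level_tangent u R z =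
     {v. dual_B u (frechet_derivative (\<lambda>y. moment R (affine_point y)) (at z) v) = dual_B u 0}"

definition horizontal ::
  "('n::finite \<Rightarrow> 'g::euclidean_space) \<Rightarrow> real \<Rightarrow> complex ^ 'n \<Rightarrow> (complex ^ 'n) set" where
  "horizontal u R z = {v \<in> level_tangent u R z. \<forall>w\<in>orbit_tangent u z. fs_metric z v w = 0}"

definition reduced_point ::
  "'g::euclidean_space set \<Rightarrow> ('n::finite \<Rightarrow> 'g) \<Rightarrow> complex ^ 'n \<Rightarrow> (complex ^ ('n option)) set set"
  where "reduced_point Z u z = orbit_K Z u (affine_point z)"

text \<open>A holomorphic coordinate chart on the part of the reduced space over the interior of the
  polytope, given in the inverse direction: \<open>x \<mapsto> reduced_point Z u (s x)\<close> maps the open set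
  \<open>U\<close> of \<open>\<complex>\<^sup>n\<close>, \<open>n = dim \<gg>\<close>, injectively and immersively to the quotient. It comes with a
  smooth lift \<open>s\<close> to the level set; as \<open>K\<close> acts freely over the interior, the level set is a
  principal \<open>K\<close>-bundle there and every chart has such lifts locally. The last clause says
  that the differential of the chart intertwines \<open>\<i>\<close> with the reduced complex structure.\<close>

definition reduced_chart ::
  "'g::euclidean_space set \<Rightarrow> ('n::finite \<Rightarrow> 'g) \<Rightarrow> ('n \<Rightarrow> real) \<Rightarrow> real
     \<Rightarrow> (complex ^ 'd::finite) set \<Rightarrow> (complex ^ 'd \<Rightarrow> complex ^ 'n) \<Rightarrow> bool" where
  "reduced_chart Z u lam R U s \<longleftrightarrow>
     CARD('d) = DIM('g) \<and> open U \<and> smooth_map_on U s \<and>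
     (\<forall>x\<in>U. affine_point (s x) \<in> level_set u lam R \<and>
             reduced_point Z u (s x) \<in> reduced_interior Z u lam R) \<and>
     inj_on (\<lambda>x. reduced_point Z u (s x)) U \<and>
     (\<forall>x\<in>U. \<forall>v. frechet_derivative s (at x) v \<in> orbit_tangent u (s x) \<longrightarrow> v = 0) \<and>
     (\<forall>x\<in>U. \<forall>v. \<exists>h\<in>horizontal u R (s x).
        frechet_derivative s (at x) v - h \<in> orbit_tangent u (s x) \<and>
        frechet_derivative s (at x) (\<i> *s v) - \<i> *s h \<in> orbit_tangent u (s x))"

text \<open>The reduced form is the 2-form on the quotient whose pullback to the level set is the
  restriction of \<open>R\<close> times the Fubini--Study form. Hence its expression in a chart with lift
  \<open>s\<close> is the pullback under \<open>s\<close> of \<open>R\<close> times the Fubini--Study form.\<close>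

definition omega_P ::
  "real \<Rightarrow> (complex ^ 'd::finite \<Rightarrow> complex ^ 'n::finite)
     \<Rightarrow> complex ^ 'd \<Rightarrow> complex ^ 'd \<Rightarrow> complex ^ 'd \<Rightarrow> complex" where
  "omega_P R s x v w =
     complex_of_real R *
     fubini_study (s x) (frechet_derivative s (at x) v) (frechet_derivative s (at x) w)"

end

theory Submission
  imports Defs
begin

text \<open>Write \<open>z\<^sub>j = exp (\<rho>\<^sub>j + \<i> \<theta>\<^sub>j)\<close> and \<open>x\<^sub>j = \<bar>z\<^sub>j\<bar>\<^sup>2 / (1 + \<parallel>z\<parallel>\<^sup>2)\<close> on the complex torus, so that the
  moment map of \<open>R \<omega>\<^bsub>FS\<^esub>\<close> has the coordinates \<open>R x\<^sub>j\<close>. Over the interior of the polytope, with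
  \<open>\<eta> = \<phi>\<^sub>P\<close>, the level set equation reads \<open>R x\<^sub>j = \<eta>(u\<^sub>j) - \<lambda>\<^sub>j\<close>. Summing over \<open>j\<close> gives
  \<open>R - \<Sum> (\<eta>(u\<^sub>j) - \<lambda>\<^sub>j) = R / (1 + \<parallel>z\<parallel>\<^sup>2)\<close>. Inserting both equations in the claimed potential and
  expanding the logarithms shows that its pullback to the level set is, up to a constant,
  the restriction of

  \<open>\<Psi>(z) = R log (1 + \<parallel>z\<parallel>\<^sup>2) + \<Sum> \<lambda>\<^sub>j log \<bar>z\<^sub>j\<bar>\<^sup>2\<close>,  with  \<open>d\<Psi> = 2 \<Sum> (R x\<^sub>j + \<lambda>\<^sub>j) d\<rho>\<^sub>j\<close>.

  Let \<open>s\<close> be a lift of a holomorphic chart and \<open>F = \<Psi> \<circ> s\<close>. In general \<open>s\<close> is not holomorphic, since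
  the level set is not a complex submanifold, but \<open>ds(\<i> v)\<close> and \<open>\<i> ds(v)\<close> differ only by vectors
  tangent to the \<open>K\<close>-orbit and by \<open>\<i>\<close> times such vectors. These change the \<open>d\<theta>\<^sub>j\<close> and the
  \<open>d\<rho>\<^sub>j\<close> by multiples of the components of some \<open>\<xi>\<close> in the Lie algebra of \<open>K\<close>, and
  \<open>\<Sum> (R x\<^sub>j + \<lambda>\<^sub>j) \<xi>\<^sub>j = \<eta>(A \<xi>) = 0\<close>. So \<open>dF \<circ> \<i> = - 2 \<Sum> (R x\<^sub>j + \<lambda>\<^sub>j) d\<theta>\<^sub>j\<close> (pulled back by \<open>s\<close>), just
  as if \<open>s\<close> were holomorphic. As the forms \<open>d\<theta>\<^sub>j\<close> are closed,

  \<open>\<i> \<partial> \<partial>bar F = - d(dF \<circ> \<i>) / 2 = R \<Sum> dx\<^sub>j \<and> d\<theta>\<^sub>j\<close>.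

  The same computation for \<open>log (1 + \<parallel>z\<parallel>\<^sup>2)\<close> on the complex torus itself yields
  \<open>\<omega>\<^bsub>FS\<^esub> = \<Sum> dx\<^sub>j \<and> d\<theta>\<^sub>j\<close>, so the two sides of the theorem agree.

  The common computation is \<open>i_ddbar_polar\<close>; closedness of the pulled back \<open>d\<theta>\<^sub>j\<close> is the symmetry
  of the second derivative of \<open>s\<close> (\<open>smooth_second_derivative\<close>), and the vanishing of the terms
  tangent to the orbits is \<open>level_set_annihilates_lie_K\<close>.\<close>


section \<open>Symmetry of the second derivative\<close>

lemma mixed_difference_mean_value:
  fixes f :: "'a::real_normed_vector \<Rightarrow> real"
  assumes t: "t > 0"
    and box: "\<And>p q. \<lbrakk>0 \<le> p; p \<le> t; 0 \<le> q; q \<le> t\<rbrakk> \<Longrightarrow> x + p *\<^sub>R a + q *\<^sub>R b \<in> U"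
    and f: "\<And>y. y \<in> U \<Longrightarrow> (f has_derivative f' y) (at y)"
    and g: "\<And>y. y \<in> U \<Longrightarrow> ((\<lambda>y. f' y a) has_derivative g y) (at y)"
  obtains p q where "0 < p" "p < t" "0 < q" "q < t"
    "f (x + t *\<^sub>R a + t *\<^sub>R b) - f (x + t *\<^sub>R a) - f (x + t *\<^sub>R b) + f x
       = t * t * g (x + p *\<^sub>R a + q *\<^sub>R b) b"
proof -
  have ray: "((\<lambda>r. h (c + r *\<^sub>R e)) has_derivative (\<lambda>d. d * h' (c + r *\<^sub>R e) e)) (at r within S)"
    if "(h has_derivative h' (c + r *\<^sub>R e)) (at (c + r *\<^sub>R e))"
    for h :: "'a \<Rightarrow> real" and h' c e r S
  proof -
    have "((\<lambda>r. c + r *\<^sub>R e) has_derivative (\<lambda>d. d *\<^sub>R e)) (at r within S)"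
      by (auto intro!: derivative_eq_intros)
    from has_derivative_compose[OF this that]
    have "((\<lambda>r. h (c + r *\<^sub>R e)) has_derivative (\<lambda>d. h' (c + r *\<^sub>R e) (d *\<^sub>R e))) (at r within S)" .
    moreover have "h' (c + r *\<^sub>R e) (d *\<^sub>R e) = d * h' (c + r *\<^sub>R e) e" for d
      using linear_cmul[OF has_derivative_linear[OF that]] by simp
    ultimately show ?thesis by simp
  qed
  have "\<exists>p\<in>{0<..<t}. (f (x + t *\<^sub>R b + t *\<^sub>R a) - f (x + t *\<^sub>R a)) - (f (x + t *\<^sub>R b + 0 *\<^sub>R a) - f (x + 0 *\<^sub>R a))
      = (t - 0) * f' (x + t *\<^sub>R b + p *\<^sub>R a) a - (t - 0) * f' (x + p *\<^sub>R a) a"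
  proof (rule mvt_simple[OF t])
    fix r assume r: "0 \<le> r" "r \<le> t"
    have "x + t *\<^sub>R b + r *\<^sub>R a \<in> U" using box[of r t] r t by (simp add: algebra_simps)
    moreover have "x + r *\<^sub>R a \<in> U" using box[of r 0] r t by simp
    ultimately show "((\<lambda>r. f (x + t *\<^sub>R b + r *\<^sub>R a) - f (x + r *\<^sub>R a)) has_derivative
        (\<lambda>d. d * f' (x + t *\<^sub>R b + r *\<^sub>R a) a - d * f' (x + r *\<^sub>R a) a)) (at r within {0..t})"
      by (intro has_derivative_diff ray f)
  qed
  then obtain p where p: "0 < p" "p < t" and
    eq1: "(f (x + t *\<^sub>R b + t *\<^sub>R a) - f (x + t *\<^sub>R a)) - (f (x + t *\<^sub>R b) - f x)
      = t * (f' (x + t *\<^sub>R b + p *\<^sub>R a) a - f' (x + p *\<^sub>R a) a)"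
    by (auto simp: algebra_simps)
  have "\<exists>q\<in>{0<..<t}. f' (x + p *\<^sub>R a + t *\<^sub>R b) a - f' (x + p *\<^sub>R a + 0 *\<^sub>R b) a
      = (t - 0) * g (x + p *\<^sub>R a + q *\<^sub>R b) b"
  proof (rule mvt_simple[OF t])
    fix r assume "0 \<le> r" "r \<le> t"
    then show "((\<lambda>r. f' (x + p *\<^sub>R a + r *\<^sub>R b) a) has_derivative
        (\<lambda>d. d * g (x + p *\<^sub>R a + r *\<^sub>R b) b)) (at r within {0..t})"
      using p by (intro ray[of "\<lambda>y. f' y a"] g box) auto
  qed
  then obtain q where "0 < q" "q < t" and
    eq2: "f' (x + p *\<^sub>R a + t *\<^sub>R b) a - f' (x + p *\<^sub>R a) a = t * g (x + p *\<^sub>R a + q *\<^sub>R b) b"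
    by auto
  then show thesis
    using p eq1 eq2 by (intro that[of p q]) (simp_all add: algebra_simps)
qed

text \<open>Young's theorem. The double difference over the parallelogram with sides \<open>t a\<close> and \<open>t b\<close> does
  not depend on the order of \<open>a\<close> and \<open>b\<close>; by the mean value theorem it is \<open>t\<^sup>2\<close> times a mixed
  second derivative at a nearby point, in either order. Let \<open>t\<close> tend to 0.\<close>
lemma second_derivative_symmetric_real:
  fixes f :: "'a::real_normed_vector \<Rightarrow> real"
  assumes "open U" "x \<in> U"
    and f: "\<And>y. y \<in> U \<Longrightarrow> (f has_derivative f' y) (at y)"
    and ga: "\<And>y. y \<in> U \<Longrightarrow> ((\<lambda>y. f' y a) has_derivative ga y) (at y)"
    and gb: "\<And>y. y \<in> U \<Longrightarrow> ((\<lambda>y. f' y b) has_derivative gb y) (at y)"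
    and ca: "continuous_on U (\<lambda>y. ga y b)" and cb: "continuous_on U (\<lambda>y. gb y a)"
  shows "ga x b = gb x a"
proof (rule ccontr)
  assume ne: "ga x b \<noteq> gb x a"
  \<comment> \<open>Each mixed derivative may move by less than \<open>e\<close>, half of the gap.\<close>
  define e where "e = \<bar>ga x b - gb x a\<bar> / 2"
  have e: "e > 0" using ne by (simp add: e_def)
  obtain d1 where d1: "d1 > 0" "\<And>y. y \<in> U \<Longrightarrow> dist y x < d1 \<Longrightarrow> \<bar>ga y b - ga x b\<bar> < e"
    using ca e \<open>x \<in> U\<close> unfolding continuous_on_iff dist_real_def by blast
  obtain d2 where d2: "d2 > 0" "\<And>y. y \<in> U \<Longrightarrow> dist y x < d2 \<Longrightarrow> \<bar>gb y a - gb x a\<bar> < e"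
    using cb e \<open>x \<in> U\<close> unfolding continuous_on_iff dist_real_def by blast
  obtain d3 where d3: "d3 > 0" "\<And>y. dist y x < d3 \<Longrightarrow> y \<in> U"
    using \<open>open U\<close> \<open>x \<in> U\<close> unfolding open_dist by blast
  define d where "d = min d1 (min d2 d3)"
  have d: "d > 0" using d1 d2 d3 by (simp add: d_def)
  \<comment> \<open>With this \<open>t\<close> the whole parallelogram lies within distance \<open>d\<close> of its corner \<open>x\<close>.\<close>
  define t where "t = d / (norm a + norm b + 1)"
  have den: "norm a + norm b + 1 > 0" by (simp add: add_nonneg_pos)
  have t: "t > 0" using d den by (simp add: t_def)
  have near: "dist (x + p *\<^sub>R a + q *\<^sub>R b) x < d" if "0 \<le> p" "p \<le> t" "0 \<le> q" "q \<le> t" for p q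
  proof -
    have "dist (x + p *\<^sub>R a + q *\<^sub>R b) x \<le> norm (p *\<^sub>R a) + norm (q *\<^sub>R b)"
      by (simp add: dist_norm algebra_simps) (metis norm_scaleR norm_triangle_ineq)
    also have "\<dots> \<le> t * norm a + t * norm b"
      using that by (intro add_mono) (simp_all add: mult_right_mono)
    also have "\<dots> < t * (norm a + norm b + 1)" using t by (simp add: algebra_simps)
    also have "\<dots> = d" using den by (simp add: t_def)
    finally show ?thesis .
  qed
  have box: "x + p *\<^sub>R a + q *\<^sub>R b \<in> U" if "0 \<le> p" "p \<le> t" "0 \<le> q" "q \<le> t" for p q
    using near[OF that] d3 by (simp add: d_def)
  have box': "x + p *\<^sub>R b + q *\<^sub>R a \<in> U" if "0 \<le> p" "p \<le> t" "0 \<le> q" "q \<le> t" for p q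
    using box[of q p] that by (simp add: algebra_simps)
  obtain p q where pq: "0 < p" "p < t" "0 < q" "q < t" and
    1: "f (x + t *\<^sub>R a + t *\<^sub>R b) - f (x + t *\<^sub>R a) - f (x + t *\<^sub>R b) + f x
          = t * t * ga (x + p *\<^sub>R a + q *\<^sub>R b) b"
    using mixed_difference_mean_value[of t x a b U f f' ga] t box f ga by blast
  obtain p' q' where pq': "0 < p'" "p' < t" "0 < q'" "q' < t" and
    2: "f (x + t *\<^sub>R b + t *\<^sub>R a) - f (x + t *\<^sub>R b) - f (x + t *\<^sub>R a) + f x
          = t * t * gb (x + p' *\<^sub>R b + q' *\<^sub>R a) a"
    using mixed_difference_mean_value[of t x b a U f f' gb] t box' f gb by blast
  have "t * t * ga (x + p *\<^sub>R a + q *\<^sub>R b) b = t * t * gb (x + p' *\<^sub>R b + q' *\<^sub>R a) a"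
    using 1 2 by (simp add: algebra_simps)
  then have eq: "ga (x + p *\<^sub>R a + q *\<^sub>R b) b = gb (x + q' *\<^sub>R a + p' *\<^sub>R b) a"
    using t by (simp add: algebra_simps)
  have "\<bar>ga (x + p *\<^sub>R a + q *\<^sub>R b) b - ga x b\<bar> < e"
    using near[of p q] box[of p q] pq by (intro d1) (auto simp: d_def)
  moreover have "\<bar>gb (x + q' *\<^sub>R a + p' *\<^sub>R b) a - gb x a\<bar> < e"
    using near[of q' p'] box[of q' p'] pq' by (intro d2) (auto simp: d_def)
  ultimately have "\<bar>ga x b - gb x a\<bar> < 2 * e" using eq by linarith
  then show False by (simp add: e_def)
qed

lemma second_derivative_symmetric:
  fixes f :: "'a::real_normed_vector \<Rightarrow> 'b::real_inner"
  assumes U: "open U" "x \<in> U"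
    and f: "\<And>y. y \<in> U \<Longrightarrow> (f has_derivative f' y) (at y)"
    and g: "\<And>v y. y \<in> U \<Longrightarrow> ((\<lambda>y. f' y v) has_derivative g v y) (at y)"
    and c: "\<And>v w. continuous_on U (\<lambda>y. g v y w)"
  shows "g a x b = g b x a"
proof -
  have "g a x b \<bullet> e = g b x a \<bullet> e" for e
  proof (rule second_derivative_symmetric_real[OF U, where f = "\<lambda>y. f y \<bullet> e" and f' = "\<lambda>y v. f' y v \<bullet> e"
        and ga = "\<lambda>y w. g a y w \<bullet> e" and gb = "\<lambda>y w. g b y w \<bullet> e"])
  qed (auto intro!: has_derivative_inner_left f g continuous_intros c)
  then show ?thesis by (metis inner_commute vector_eq_rdot)
qed

lemma smooth_second_derivative:
  fixes f :: "'a::real_normed_vector \<Rightarrow> 'b::real_inner"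
  assumes "smooth_map_on U f" "open U" "x \<in> U"
  obtains H where "\<And>v. ((\<lambda>y. frechet_derivative f (at y) v) has_derivative (\<lambda>w. H w v)) (at x)"
    "\<And>v w. H v w = H w v"
proof -
  define D where "D y v = frechet_derivative f (at y) v" for y v
  define g where "g v y = frechet_derivative (\<lambda>y. D y v) (at y)" for v y
  have "diff_order_on (Suc (Suc 0)) U f" using assms(1) by (simp add: smooth_map_on_def)
  then have 1: "\<And>y. y \<in> U \<Longrightarrow> f differentiable (at y)"
    and 2: "\<And>y v. y \<in> U \<Longrightarrow> (\<lambda>y. D y v) differentiable (at y)"
    and 3: "\<And>v w. continuous_on U (\<lambda>y. g v y w)"
    by (auto simp: D_def g_def)
  have f: "(f has_derivative D y) (at y)" if "y \<in> U" for y
    using 1[OF that] by (simp add: D_def[abs_def] frechet_derivative_works)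
  have g: "((\<lambda>y. D y v) has_derivative g v y) (at y)" if "y \<in> U" for v y
    using 2[OF that] by (simp add: g_def frechet_derivative_works)
  show thesis
  proof (rule that[of "\<lambda>w v. g v x w"])
    show "((\<lambda>y. frechet_derivative f (at y) v) has_derivative g v x) (at x)" for v
      using g[OF assms(3), of v] by (simp add: D_def)
    show "g w x v = g v x w" for v w
      using second_derivative_symmetric[OF assms(2,3) f g 3] by blast
  qed
qed


section \<open>The operator in terms of the Hessian\<close>

lemma i_smult_twice: "\<i> *s (\<i> *s a) = - (a :: complex ^ 'n)"
  by (simp add: vec_eq_iff)

lemma i_smult_scaleR: "\<i> *s (r *\<^sub>R a) = r *\<^sub>R (\<i> *s (a :: complex ^ 'n))"
  by (simp add: vec_eq_iff)

lemma complex_smult_decompose: "c *s a = Re c *\<^sub>R a + Im c *\<^sub>R (\<i> *s (a :: complex ^ 'n))"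
  by (simp add: vec_eq_iff complex_eq_iff)

text \<open>This is \<open>\<i> \<partial> \<partial>bar f = - d(df \<circ> \<i>) / 2\<close>, in terms of the real Hessian \<open>H\<close> of \<open>f\<close>. The matrix of
  complex second derivatives is the sesquilinear part \<open>M\<close> of \<open>H\<close>; antisymmetrising it leaves
  only the values of \<open>H\<close> on pairs with one argument multiplied by \<open>\<i>\<close>.\<close>
lemma i_ddbar_hessian:
  fixes f :: "complex ^ 'n::finite \<Rightarrow> real"
  assumes U: "open U" "x \<in> U"
    and f: "\<And>y. y \<in> U \<Longrightarrow> (f has_derivative f' y) (at y)"
    and H: "\<And>b. ((\<lambda>y. f' y b) has_derivative (\<lambda>a. H a b)) (at x)"
    and sym: "\<And>a b. H a b = H b a"
  shows "i_ddbar f x v w = complex_of_real ((H w (\<i> *s v) - H v (\<i> *s w)) / 2)"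
proof -
  have linL: "linear (\<lambda>a. H a b)" for b by (rule has_derivative_linear[OF H])
  have linR: "linear (\<lambda>b. H a b)" for a using linL[of a] sym by simp
  note Hs = linear_add[OF linL] linear_add[OF linR] linear_cmul[OF linL] linear_cmul[OF linR]
    linear_neg[OF linL] linear_neg[OF linR] linear_diff[OF linL] linear_diff[OF linR]
  define M where "M a b = (complex_of_real (H a b + H (\<i> *s a) (\<i> *s b))
      + \<i> * complex_of_real (H a (\<i> *s b) - H (\<i> *s a) b)) / 4" for a b
  have lin_M: "M (a + a') b = M a b + M a' b" "M a (b + b') = M a b + M a b'" for a a' b b'
    unfolding M_def vector_add_ldistrib by (simp_all add: Hs field_simps)
  have Ml: "M (c *s a) b = c * M a b" for c a b
    unfolding M_def complex_smult_decompose[of c]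
    by (simp add: Hs i_smult_twice i_smult_scaleR vector_add_ldistrib)
       (simp add: complex_eq_iff field_simps)
  have Mr: "M a (c *s b) = cnj c * M a b" for c a b
    unfolding M_def complex_smult_decompose[of c]
    by (simp add: Hs i_smult_twice i_smult_scaleR vector_add_ldistrib)
       (simp add: complex_eq_iff field_simps)
  have M0: "M 0 b = 0" "M a 0 = 0" for a b
    using Ml[of 0 0 b] Mr[of a 0 0] by simp_all
  have sum_l: "M (\<Sum>j\<in>S. a j) b = (\<Sum>j\<in>S. M (a j) b)" for S :: "'n set" and a b
    by (induction S rule: infinite_finite_induct) (simp_all add: lin_M M0)
  have sum_r: "M a (\<Sum>j\<in>S. b j) = (\<Sum>j\<in>S. M a (b j))" for S :: "'n set" and a b
    by (induction S rule: infinite_finite_induct) (simp_all add: lin_M M0)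
  have axis_i: "axis k \<i> = \<i> *s (axis k 1 :: complex ^ 'n)" for k
    by (simp add: vec_eq_iff axis_def)
  have expand: "v = (\<Sum>j\<in>UNIV. (v $ j) *s axis j 1)" for v :: "complex ^ 'n"
    by (simp add: vec_eq_iff axis_def if_distrib cong: if_cong)
  have 1: "d_z j (d_zbar k (\<lambda>y. complex_of_real (f y))) x = M (axis j 1) (axis k 1)" for j k
  proof -
    define F where "F y = (complex_of_real (f' y (axis k 1)) + \<i> * complex_of_real (f' y (axis k \<i>))) / 2" for y
    have zbar: "F y = d_zbar k (\<lambda>y. complex_of_real (f y)) y" if "y \<in> U" for y
    proof -
      have "((\<lambda>y. complex_of_real (f y)) has_derivative (\<lambda>v. complex_of_real (f' y v))) (at y)"
        by (intro has_derivative_of_real f that)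
      from frechet_derivative_at[OF this] show ?thesis
        by (simp add: F_def d_zbar_def fun_eq_iff)
    qed
    have "(F has_derivative (\<lambda>a. (complex_of_real (H a (axis k 1)) + \<i> * complex_of_real (H a (axis k \<i>))) / 2)) (at x)"
      unfolding F_def by (auto intro!: derivative_eq_intros H)
    then have "(d_zbar k (\<lambda>y. complex_of_real (f y)) has_derivative
        (\<lambda>a. (complex_of_real (H a (axis k 1)) + \<i> * complex_of_real (H a (axis k \<i>))) / 2)) (at x)"
      by (rule has_derivative_transform_within_open[OF _ U]) (rule zbar)
    from frechet_derivative_at[OF this, symmetric] show ?thesis
      by (simp add: d_z_def M_def axis_i complex_eq_iff field_simps)
  qed
  have 2: "(\<Sum>j\<in>UNIV. \<Sum>k\<in>UNIV. M (axis j 1) (axis k 1) * (v $ j * cnj (w $ k))) = M v w" for v w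
  proof -
    have "M v w = M (\<Sum>j\<in>UNIV. (v $ j) *s axis j 1) (\<Sum>k\<in>UNIV. (w $ k) *s axis k 1)"
      by (simp only: expand[symmetric])
    then show ?thesis by (simp add: sum_l sum_r Ml Mr sum_distrib_left mult_ac) (rule sum.swap)
  qed
  have "i_ddbar f x v w = \<i> * (M v w - M w v)"
    unfolding i_ddbar_def 1 right_diff_distrib sum_subtractf 2
    by (simp add: right_diff_distrib)
  also have "\<dots> = complex_of_real ((H w (\<i> *s v) - H v (\<i> *s w)) / 2)"
    using sym[of v w] sym[of "\<i> *s v" "\<i> *s w"] sym[of "\<i> *s v" w] sym[of "\<i> *s w" v]
    by (simp add: M_def complex_eq_iff field_simps)
  finally show ?thesis .
qed


section \<open>Functions with a differential in polar form\<close>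

text \<open>Here \<open>\<beta> j\<close> stands for the complex 1-form \<open>d\<rho>\<^sub>j + \<i> d\<theta>\<^sub>j\<close>. The hypotheses say that
  \<open>df = 2 \<Sum> E\<^sub>j d\<rho>\<^sub>j\<close>, that composition with \<open>\<i>\<close> turns this into \<open>- 2 \<Sum> E\<^sub>j d\<theta>\<^sub>j\<close>, and (\<open>C\<close>) that
  \<open>\<beta> j\<close> is closed, so \<open>- d(df \<circ> \<i>) / 2\<close> is \<open>\<Sum> dE\<^sub>j \<and> d\<theta>\<^sub>j\<close>. The last hypothesis is the symmetry of
  the Hessian, \<open>\<Sum> dE\<^sub>j \<and> d\<rho>\<^sub>j = 0\<close>. Only the sums are required to rotate, not the
  individual \<open>\<beta> j\<close>: this is what makes the lemma applicable to maps that are holomorphic only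
  modulo the orbits of \<open>K\<close>.\<close>
lemma i_ddbar_polar:
  fixes f :: "complex ^ 'n::finite \<Rightarrow> real" and E :: "'m::finite \<Rightarrow> complex ^ 'n \<Rightarrow> real"
  assumes U: "open U" "x \<in> U"
    and f: "\<And>y. y \<in> U \<Longrightarrow> (f has_derivative (\<lambda>b. 2 * (\<Sum>j\<in>UNIV. E j y * Re (\<beta> j y b)))) (at y)"
    and rot: "\<And>y b. y \<in> U \<Longrightarrow>
      (\<Sum>j\<in>UNIV. E j y * Re (\<beta> j y (\<i> *s b))) = - (\<Sum>j\<in>UNIV. E j y * Im (\<beta> j y b))"
    and E: "\<And>j. (E j has_derivative E' j) (at x)"
    and \<beta>: "\<And>j b. ((\<lambda>y. \<beta> j y b) has_derivative (\<lambda>a. C j a b)) (at x)"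
    and C: "\<And>j a b. C j a b = C j b a"
    and sym: "\<And>a b. (\<Sum>j\<in>UNIV. E' j a * Re (\<beta> j x b)) = (\<Sum>j\<in>UNIV. E' j b * Re (\<beta> j x a))"
  shows "i_ddbar f x v w =
    complex_of_real (\<Sum>j\<in>UNIV. E' j v * Im (\<beta> j x w) - E' j w * Im (\<beta> j x v))"
proof -
  define H where "H a b = 2 * (\<Sum>j\<in>UNIV. E' j a * Re (\<beta> j x b) + E j x * Re (C j a b))" for a b
  have H: "((\<lambda>y. 2 * (\<Sum>j\<in>UNIV. E j y * Re (\<beta> j y b))) has_derivative (\<lambda>a. H a b)) (at x)" for b
    unfolding H_def
    by (auto intro!: derivative_eq_intros E \<beta> has_derivative_Re sum.cong simp: algebra_simps)
  have H_sym: "H a b = H b a" for a b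
    using sym[of a b] C[of _ a b] by (simp add: H_def sum.distrib)
  have H_i: "H a (\<i> *s b) = - 2 * (\<Sum>j\<in>UNIV. E' j a * Im (\<beta> j x b) + E j x * Im (C j a b))" for a b
  proof -
    have "((\<lambda>y. - 2 * (\<Sum>j\<in>UNIV. E j y * Im (\<beta> j y b))) has_derivative
      (\<lambda>a. - 2 * (\<Sum>j\<in>UNIV. E' j a * Im (\<beta> j x b) + E j x * Im (C j a b)))) (at x)"
      by (auto intro!: derivative_eq_intros E \<beta> has_derivative_Im sum.cong simp: algebra_simps)
    then have "((\<lambda>y. 2 * (\<Sum>j\<in>UNIV. E j y * Re (\<beta> j y (\<i> *s b)))) has_derivative
      (\<lambda>a. - 2 * (\<Sum>j\<in>UNIV. E' j a * Im (\<beta> j x b) + E j x * Im (C j a b)))) (at x)"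
      by (rule has_derivative_transform_within_open[OF _ U]) (simp add: rot)
    from has_derivative_unique[OF H this] show ?thesis by (simp add: fun_eq_iff)
  qed
  have "H w (\<i> *s v) - H v (\<i> *s w) =
      2 * (\<Sum>j\<in>UNIV. E' j v * Im (\<beta> j x w) - E' j w * Im (\<beta> j x v))"
    unfolding H_i using C[of _ v w] by (simp add: sum.distrib sum_subtractf algebra_simps)
  then show ?thesis
    using i_ddbar_hessian[OF U f H H_sym, of v w] by simp
qed


section \<open>The Fubini--Study form in polar coordinates\<close>

definition moment_coord :: "'n::finite \<Rightarrow> complex ^ 'n \<Rightarrow> real" where
  "moment_coord j z = (cmod (z $ j))\<^sup>2 / (1 + (\<Sum>k\<in>UNIV. (cmod (z $ k))\<^sup>2))"

definition moment_coord_deriv :: "'n::finite \<Rightarrow> complex ^ 'n \<Rightarrow> complex ^ 'n \<Rightarrow> real" where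
  "moment_coord_deriv j z p = (let D = 1 + (\<Sum>k\<in>UNIV. (cmod (z $ k))\<^sup>2) in
     2 * (z $ j \<bullet> p $ j) / D - 2 * (cmod (z $ j))\<^sup>2 * (z \<bullet> p) / D\<^sup>2)"

lemma sum_cmod_power2: "(\<Sum>k\<in>UNIV. (cmod (z $ k))\<^sup>2) = z \<bullet> z"
  by (simp add: inner_vec_def power2_norm_eq_inner)

lemma one_plus_inner_pos: "1 + z \<bullet> (z :: 'a::real_inner) > 0"
  using inner_ge_zero[of z] by linarith

lemma has_derivative_moment_coord:
  "(moment_coord j has_derivative moment_coord_deriv j z) (at z)"
proof -
  define D where "D = 1 + z \<bullet> z"
  have D: "D > 0" using one_plus_inner_pos[of z] by (simp add: D_def)
  have "((\<lambda>z. (z $ j \<bullet> z $ j) / (1 + z \<bullet> z)) has_derivative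
     (\<lambda>p. (2 * (z $ j \<bullet> p $ j) * D - (z $ j \<bullet> z $ j) * (2 * (z \<bullet> p))) / (D * D))) (at z)"
    using D unfolding D_def
    by (auto intro!: derivative_eq_intros bounded_linear.has_derivative[OF bounded_linear_vec_nth]
        simp: inner_commute)
  moreover have "(2 * (z $ j \<bullet> p $ j) * D - (z $ j \<bullet> z $ j) * (2 * (z \<bullet> p))) / (D * D)
      = 2 * (z $ j \<bullet> p $ j) / D - 2 * (z $ j \<bullet> z $ j) * (z \<bullet> p) / D\<^sup>2" for p
    using D by (simp add: diff_divide_distrib power2_eq_square)
  ultimately have "((\<lambda>z. (z $ j \<bullet> z $ j) / (1 + z \<bullet> z)) has_derivative
     (\<lambda>p. 2 * (z $ j \<bullet> p $ j) / D - 2 * (z $ j \<bullet> z $ j) * (z \<bullet> p) / D\<^sup>2)) (at z)"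
    by simp
  then show ?thesis
    unfolding moment_coord_def[abs_def] moment_coord_deriv_def[abs_def] sum_cmod_power2 Let_def
    by (simp add: power2_norm_eq_inner D_def)
qed

text \<open>In polar coordinates: \<open>r\<^sup>2 d\<rho> = r dr\<close>, as \<open>\<rho> = log r\<close>.\<close>
lemma cmod_power2_mult_Re_divide: "(cmod z)\<^sup>2 * Re (b / z) = z \<bullet> b"
  by (cases "z = 0") (auto simp: Re_divide inner_complex_def cmod_power2 mult.commute)

lemma inner_times_Re_divide:
  assumes "z \<noteq> 0"
  shows "(z \<bullet> a) * Re (b / z) = (z \<bullet> b) * Re (a / z)"
  using cmod_power2_mult_Re_divide[of z a] cmod_power2_mult_Re_divide[of z b]
  by (metis mult.assoc mult.commute)

text \<open>\<open>\<Sum> dx\<^sub>j \<and> d\<rho>\<^sub>j = 0\<close>: the \<open>2 x\<^sub>j\<close> are the partial derivatives of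
  \<open>log (1 + \<Sum> exp (2 \<rho>\<^sub>j))\<close> with respect to the \<open>\<rho>\<^sub>j\<close>.\<close>
lemma moment_coord_deriv_symmetric:
  assumes "\<And>j. z $ j \<noteq> 0"
  shows "(\<Sum>j\<in>UNIV. moment_coord_deriv j z p * Re (q $ j / z $ j)) =
         (\<Sum>j\<in>UNIV. moment_coord_deriv j z q * Re (p $ j / z $ j))"
proof -
  define D where "D = 1 + (\<Sum>k\<in>UNIV. (cmod (z $ k))\<^sup>2)"
  have *: "(\<Sum>j\<in>UNIV. moment_coord_deriv j z p * Re (q $ j / z $ j)) =
      2 * (\<Sum>j\<in>UNIV. (z $ j \<bullet> p $ j) * Re (q $ j / z $ j)) / D - 2 * (z \<bullet> p) * (z \<bullet> q) / D\<^sup>2" for p q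
  proof -
    have "moment_coord_deriv j z p * Re (q $ j / z $ j) =
      2 * ((z $ j \<bullet> p $ j) * Re (q $ j / z $ j)) / D
      - 2 * (z \<bullet> p) * (z $ j \<bullet> q $ j) / D\<^sup>2" for j
      unfolding cmod_power2_mult_Re_divide[of "z $ j" "q $ j", symmetric]
      by (simp add: moment_coord_deriv_def Let_def D_def[symmetric] algebra_simps diff_divide_distrib)
    then show ?thesis
      by (simp add: sum_subtractf sum_divide_distrib sum_distrib_left inner_vec_def[of z q])
  qed
  show ?thesis
    unfolding * using inner_times_Re_divide[OF assms] by (simp add: algebra_simps)
qed

lemma has_derivative_ln_one_plus_norm:
  "((\<lambda>z. ln (1 + (\<Sum>j\<in>UNIV. (cmod (z $ j))\<^sup>2))) has_derivative
      (\<lambda>b. 2 * (\<Sum>j\<in>UNIV. moment_coord j z * Re (b $ j / z $ j)))) (at z)"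
proof -
  have "((\<lambda>z. ln (1 + z \<bullet> z)) has_derivative (\<lambda>b. 2 * (z \<bullet> b) / (1 + z \<bullet> z))) (at z)"
    using one_plus_inner_pos[of z]
    by (auto intro!: derivative_eq_intros simp: inner_commute field_simps)
  moreover have "2 * (\<Sum>j\<in>UNIV. moment_coord j z * Re (b $ j / z $ j)) = 2 * (z \<bullet> b) / (1 + z \<bullet> z)" for b
    unfolding moment_coord_def inner_vec_def[of z b] sum_cmod_power2
      cmod_power2_mult_Re_divide[symmetric]
    by (simp add: sum_divide_distrib sum_distrib_left mult.assoc)
  ultimately show ?thesis by (simp add: sum_cmod_power2)
qed

text \<open>On the complex torus \<open>dz\<^sub>j / z\<^sub>j = d\<rho>\<^sub>j + \<i> d\<theta>\<^sub>j\<close>, and the potential has the differential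
  \<open>2 \<Sum> x\<^sub>j d\<rho>\<^sub>j\<close>, so that \<open>\<omega>\<^bsub>FS\<^esub> = \<Sum> dx\<^sub>j \<and> d\<theta>\<^sub>j\<close>.\<close>
lemma fubini_study_polar:
  fixes z :: "complex ^ 'n::finite"
  assumes z: "\<And>j. z $ j \<noteq> 0"
  shows "fubini_study z p q = complex_of_real
    (\<Sum>j\<in>UNIV. moment_coord_deriv j z p * Im (q $ j / z $ j)
      - moment_coord_deriv j z q * Im (p $ j / z $ j))"
  unfolding fubini_study_def
proof (rule i_ddbar_polar[where U = "{z. \<forall>j. z $ j \<noteq> 0}" and E = moment_coord
      and \<beta> = "\<lambda>j y b. b $ j / y $ j" and C = "\<lambda>j a b. - (a $ j * b $ j) / (z $ j)\<^sup>2"])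
  have "{z :: complex ^ 'n. \<forall>j. z $ j \<noteq> 0} = (\<Inter>j\<in>UNIV. {z. z $ j \<noteq> 0})" by auto
  also have "open \<dots>"
    by (intro open_INT ballI open_Collect_neq) (auto intro: continuous_intros)
  finally show "open {z :: complex ^ 'n. \<forall>j. z $ j \<noteq> 0}" .
  show "((\<lambda>y. b $ j / y $ j) has_derivative (\<lambda>a. - (a $ j * b $ j) / (z $ j)\<^sup>2)) (at z)" for j b
    using z[of j]
    by (auto intro!: derivative_eq_intros bounded_linear.has_derivative[OF bounded_linear_vec_nth]
        simp: field_simps power2_eq_square)
  show "(\<Sum>j\<in>UNIV. moment_coord j y * Re ((\<i> *s b) $ j / y $ j)) =
      - (\<Sum>j\<in>UNIV. moment_coord j y * Im (b $ j / y $ j))" for y b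
    by (simp add: times_divide_eq_right[symmetric] sum_negf del: times_divide_eq_right)
qed (use z in \<open>auto simp: has_derivative_ln_one_plus_norm has_derivative_moment_coord mult.commute
      intro!: moment_coord_deriv_symmetric\<close>)


section \<open>The linear data\<close>

lemma map_A_apply: "map_A u t = (\<Sum>j\<in>UNIV. (t $ j) *\<^sub>R u j)"
  unfolding map_A_def
  by (subst bounded_linear_Blinfun_apply)
     (auto intro!: bounded_linear_sum bounded_linear_scaleR_const bounded_linear_vec_nth)

lemma dual_basis_apply: "dual_basis j t = t $ j"
  unfolding dual_basis_def by (subst bounded_linear_Blinfun_apply) (rule bounded_linear_vec_nth refl)+

lemma lam_vec_apply: "lam_vec lam t = (\<Sum>j\<in>UNIV. lam j * t $ j)"
  by (simp add: lam_vec_def blinfun.sum_left blinfun.scaleR_left dual_basis_apply)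

lemma map_A_axis:
  fixes u :: "'n::finite \<Rightarrow> 'g::euclidean_space"
  shows "map_A u (axis j 1) = u j"
proof -
  have "(\<Sum>k\<in>UNIV. (axis j 1 :: real ^ 'n) $ k *\<^sub>R u k) = (\<Sum>k\<in>UNIV. if k = j then u k else 0)"
    by (rule sum.cong) (auto simp: axis_def)
  then show ?thesis by (simp add: map_A_apply)
qed

lemma surj_map_A:
  assumes "span (range u) = UNIV"
  shows "surj (blinfun_apply (map_A u))"
proof -
  have lin: "linear (blinfun_apply (map_A u))"
    by (simp add: blinfun.bounded_linear_right bounded_linear.linear)
  have "range u \<subseteq> range (blinfun_apply (map_A u))"
    by (metis image_subsetI map_A_axis rangeI)
  then have "span (range u) \<subseteq> range (blinfun_apply (map_A u))"
    by (rule span_minimal) (rule linear_subspace_image[OF lin subspace_UNIV])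
  then show ?thesis using assms by auto
qed

lemma inj_iota:
  assumes "span (range u) = UNIV"
  shows "inj (iota u lam)"
proof (rule injI, rule blinfun_eqI)
  fix l l' i
  assume eq: "iota u lam l = iota u lam l'"
  obtain t where t: "i = map_A u t" using surj_map_A[OF assms] by (metis surjE)
  have "dual_A u l t = dual_A u l' t" using eq by (simp add: iota_def)
  then show "l i = l' i" by (simp add: t dual_A_def)
qed

lemma iota_axis:
  fixes u :: "'n::finite \<Rightarrow> 'g::euclidean_space"
  shows "iota u lam \<eta> (axis j 1) = \<eta> (u j) - lam j"
proof -
  have "(\<Sum>k\<in>UNIV. lam k * (axis j 1 :: real ^ 'n) $ k) = (\<Sum>k\<in>UNIV. if k = j then lam k else 0)"
    by (rule sum.cong) (auto simp: axis_def)
  then show ?thesis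
    by (simp add: iota_def dual_A_def blinfun.diff_left lam_vec_apply map_A_axis)
qed

lemma dual_B_eq_iff: "dual_B u l = dual_B u l' \<longleftrightarrow> (\<forall>\<xi>\<in>lie_K u. l \<xi> = l' \<xi>)"
  by (auto simp: dual_B_def restrict_def fun_eq_iff)

text \<open>The level set equation says that \<open>m + \<lambda>\<close> vanishes on the kernel of \<open>A\<close>. Since \<open>A\<close> is
  surjective, \<open>m + \<lambda>\<close> then factors through \<open>A\<close>, which gives the point of the dual space
  that \<open>\<iota>\<^sub>\<lambda>\<close> sends to \<open>m\<close>.\<close>
lemma range_iota:
  fixes u :: "'n::finite \<Rightarrow> 'g::euclidean_space"
  assumes span: "span (range u) = UNIV" and "dual_B u m = nu u lam"
  shows "m \<in> range (iota u lam)"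
proof -
  define l where "l = m + lam_vec lam"
  have l0: "l \<xi> = 0" if "map_A u \<xi> = 0" for \<xi>
    using assms(2) that
    by (simp add: l_def nu_def dual_B_eq_iff lie_K_def blinfun.add_left blinfun.minus_left)
  have "linear (blinfun_apply (map_A u))"
    by (simp add: blinfun.bounded_linear_right bounded_linear.linear)
  then obtain L where L: "linear L" "blinfun_apply (map_A u) \<circ> L = id"
    using linear_surjective_right_inverse surj_map_A[OF span] by blast
  have bl: "bounded_linear (\<lambda>x. l (L x))"
    using L(1) by (intro bounded_linear_compose[OF blinfun.bounded_linear_right])
      (simp add: linear_conv_bounded_linear)
  have "l (L (map_A u t)) = l t" for t
  proof -
    have "map_A u (L (map_A u t) - t) = 0"
      using L(2) by (simp add: blinfun.diff_right fun_eq_iff)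
    from l0[OF this] show ?thesis by (simp add: blinfun.diff_right)
  qed
  then have "dual_A u (Blinfun (\<lambda>x. l (L x))) = l"
    by (intro blinfun_eqI) (simp add: dual_A_def bounded_linear_Blinfun_apply[OF bl])
  then have "iota u lam (Blinfun (\<lambda>x. l (L x))) = m" by (simp add: iota_def l_def)
  then show ?thesis by blast
qed

text \<open>At an interior point the functional can be moved a little in a direction that decreases its
  value on \<open>u j\<close>, without leaving the polytope.\<close>
lemma interior_polytope_P_strict:
  assumes "\<eta> \<in> interior (polytope_P u lam)" and u: "u j \<noteq> 0"
  shows "\<eta> (u j) > lam j"
proof -
  obtain e where e: "e > 0" "ball \<eta> e \<subseteq> polytope_P u lam"
    using assms(1) mem_interior by blast
  define b where "b = blinfun_inner_right (u j)"
  define c where "c = norm b + 1"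
  define d where "d = e / 2 / c"
  have nb: "c > 0" by (simp add: c_def add_nonneg_pos)
  have d: "d > 0" using e nb by (simp add: d_def)
  have "norm (d *\<^sub>R b) \<le> d * c" using d by (simp add: c_def algebra_simps)
  also have "\<dots> = e / 2" using nb by (simp add: d_def)
  also have "\<dots> < e" using e by simp
  finally have "\<eta> - d *\<^sub>R b \<in> ball \<eta> e" by (simp add: dist_norm)
  with e have "\<eta> - d *\<^sub>R b \<in> polytope_P u lam" by blast
  then have "\<eta> (u j) - d * (u j \<bullet> u j) \<ge> lam j"
    by (simp add: polytope_P_def b_def blinfun.diff_left blinfun.scaleR_left)
  moreover have "d * (u j \<bullet> u j) > 0" using d u by simp
  ultimately show ?thesis by linarith
qed


section \<open>The moment map on the reduced space\<close>

lemma full_lattice_sum_closed: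
  assumes "full_lattice Z" and u: "\<And>j. u j \<in> Z"
  shows "(\<Sum>j\<in>S. of_int (c j) *\<^sub>R u j) \<in> Z"
proof -
  obtain B where Z: "Z = {\<Sum>b\<in>B. of_int (c b) *\<^sub>R b | c :: 'a \<Rightarrow> int. True}"
    using assms(1) unfolding full_lattice_def by blast
  have "\<exists>k :: 'a \<Rightarrow> int. u j = (\<Sum>b\<in>B. of_int (k b) *\<^sub>R b)" for j
    using u[of j] Z by blast
  then obtain k :: "_ \<Rightarrow> 'a \<Rightarrow> int" where k: "\<And>j. u j = (\<Sum>b\<in>B. of_int (k j b) *\<^sub>R b)"
    by metis
  have "(\<Sum>j\<in>S. of_int (c j) *\<^sub>R u j) = (\<Sum>b\<in>B. of_int (\<Sum>j\<in>S. c j * k j b) *\<^sub>R b)"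
    unfolding k by (simp add: scaleR_sum_right scaleR_sum_left) (rule sum.swap)
  then show ?thesis unfolding Z by (intro CollectI exI[of _ "\<lambda>b. \<Sum>j\<in>S. c j * k j b"]) simp
qed

lemma full_lattice_add_closed:
  assumes Z: "full_lattice Z" and "a \<in> Z" "b \<in> Z"
  shows "a + b \<in> Z"
proof -
  have "(\<Sum>j\<in>UNIV. of_int 1 *\<^sub>R (if j then a else b)) \<in> Z"
    using assms by (intro full_lattice_sum_closed) auto
  then show ?thesis by (simp add: UNIV_bool add.commute)
qed

text \<open>The neutral element of \<open>K\<close>. It is needed to know that the orbits of \<open>K\<close> are nonempty, so that
  the common value of the moment map on an orbit is well defined.\<close>
lemma std_lattice_in_group_K:
  assumes Z: "full_lattice Z" and u: "\<And>j. u j \<in> Z"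
  shows "std_lattice \<in> group_K Z u"
proof -
  have A: "map_A u t \<in> Z" if "t \<in> std_lattice" for t
  proof -
    have "\<exists>c. \<forall>j. t $ j = of_int (c j)" using that by (auto simp: std_lattice_def Ints_def image_iff) metis
    then obtain c where "\<And>j. t $ j = of_int (c j)" by blast
    then show ?thesis using full_lattice_sum_closed[OF Z u] by (simp add: map_A_apply)
  qed
  have "map_Abar Z u std_lattice = Z"
  proof
    show "map_Abar Z u std_lattice \<subseteq> Z"
      using A full_lattice_add_closed[OF Z] by (auto simp: map_Abar_def set_mult_def add_grp_def)
    have "(0 :: real ^ 'b) \<in> std_lattice" by (simp add: std_lattice_def)
    moreover have "z = map_A u 0 + z" for z by (simp add: blinfun.zero_right)
    ultimately show "Z \<subseteq> map_Abar Z u std_lattice"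
      unfolding map_Abar_def set_mult_def add_grp_def by fastforce
  qed
  moreover have "std_lattice \<in> rcosets\<^bsub>add_grp\<^esub> (std_lattice :: (real ^ 'b) set)"
  proof -
    have "(std_lattice :: (real ^ 'b) set) = std_lattice #>\<^bsub>add_grp\<^esub> 0"
      by (simp add: r_coset_def add_grp_def)
    then show ?thesis by (auto simp: RCOSETS_def add_grp_def)
  qed
  ultimately show ?thesis by (simp add: group_K_def kernel_def torus_def FactGroup_def)
qed

lemma moment_hom_scale:
  assumes "c \<noteq> 0"
  shows "moment_hom R (c *s v) = moment_hom R v"
proof -
  have "(cmod ((c *s v) $ k))\<^sup>2 / (\<Sum>k\<in>UNIV. (cmod ((c *s v) $ k))\<^sup>2)
      = (cmod (v $ k))\<^sup>2 / (\<Sum>k\<in>UNIV. (cmod (v $ k))\<^sup>2)" for k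
    unfolding vector_smult_component norm_mult power_mult_distrib sum_distrib_left[symmetric]
    using assms by simp
  then show ?thesis by (simp add: moment_hom_def)
qed

lemma moment_line_through:
  assumes "v \<noteq> 0"
  shows "moment R (line_through v) = moment_hom R v"
proof -
  have "moment_hom R w = moment_hom R v" if "w \<in> line_through v - {0}" for w
    using that moment_hom_scale by (auto simp: line_through_def)
  moreover have "v \<in> line_through v - {0}"
    using assms rangeI[of "\<lambda>c. c *s v" 1] by (simp add: line_through_def)
  ultimately have "moment_hom R ` (line_through v - {0}) = {moment_hom R v}" by blast
  then show ?thesis by (simp add: moment_def)
qed

lemma cmod_torus_act: "cmod (torus_act t v $ k) = cmod (v $ k)"
  by (cases k) (simp_all add: torus_act_def norm_mult)

lemma torus_act_line_through: "torus_act t ` line_through v = line_through (torus_act t v)"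
proof -
  have "torus_act t (c *s v) = c *s torus_act t v" for c
    by (auto simp: torus_act_def vec_eq_iff split: option.split)
  then show ?thesis by (simp add: line_through_def image_image)
qed

lemma moment_torus_act:
  assumes "v \<noteq> 0"
  shows "moment R (torus_act t ` line_through v) = moment R (line_through v)"
proof -
  obtain k where "v $ k \<noteq> 0" using assms by (auto simp: vec_eq_iff)
  then have "torus_act t v \<noteq> 0" by (metis cmod_torus_act norm_eq_zero zero_index)
  then show ?thesis
    by (simp add: torus_act_line_through moment_line_through assms moment_hom_def cmod_torus_act)
qed

lemma moment_affine_point:
  "moment R (affine_point z) t = R * (\<Sum>j\<in>UNIV. moment_coord j z * t $ j)"
proof -
  define v where "v = (\<chi> i. case i of None \<Rightarrow> 1 | Some j \<Rightarrow> z $ j)"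
  have v: "v $ None = 1" "\<And>j. v $ Some j = z $ j" by (simp_all add: v_def)
  then have "v \<noteq> 0" by (metis zero_index zero_neq_one)
  moreover have "(\<Sum>k\<in>UNIV. (cmod (v $ k))\<^sup>2) = 1 + (\<Sum>k\<in>UNIV. (cmod (z $ k))\<^sup>2)"
    by (simp add: UNIV_option_conv sum.reindex v)
  ultimately show ?thesis
    unfolding affine_point_def v_def[symmetric]
    by (simp add: moment_line_through moment_hom_def v moment_coord_def blinfun.sum_left
        blinfun.scaleR_left dual_basis_apply)
qed

lemma affine_point_line:
  obtains v where "v \<noteq> 0" "affine_point z = line_through v"
proof -
  have "(\<chi> i. case i of None \<Rightarrow> 1 | Some j \<Rightarrow> z $ j) \<noteq> (0 :: complex ^ 'a option)"
    by (auto simp: vec_eq_iff intro!: exI[of _ None])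
  then show thesis using that by (auto simp: affine_point_def)
qed

text \<open>The moment map is constant on \<open>K\<close>-orbits, since it depends only on absolute values of
  homogeneous coordinates; so \<open>\<phi>\<^sub>P\<close> of an orbit can be read off at any of its points.\<close>
lemma iota_moment_P:
  fixes u :: "'n::finite \<Rightarrow> 'g::euclidean_space"
  assumes Z: "full_lattice Z" and u: "\<And>j. u j \<in> Z" and span: "span (range u) = UNIV"
    and level: "affine_point z \<in> level_set u lam R"
  shows "iota u lam (moment_P u lam R (reduced_point Z u z)) = moment R (affine_point z)"
proof -
  obtain v where v: "v \<noteq> 0" "affine_point z = line_through v" by (rule affine_point_line)
  have ne: "orbit_K Z u (affine_point z) \<noteq> {}"
  proof -
    have "(0 :: real ^ 'n) \<in> std_lattice" by (simp add: std_lattice_def)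
    with std_lattice_in_group_K[of Z u, OF Z u] show ?thesis unfolding orbit_K_def by blast
  qed
  have "moment R p = moment R (affine_point z)" if p: "p \<in> orbit_K Z u (affine_point z)" for p
  proof -
    obtain t where "p = torus_act t ` line_through v"
      using p unfolding orbit_K_def v(2) by blast
    then show ?thesis using moment_torus_act[OF v(1)] by (simp only: v(2))
  qed
  then have "moment R ` orbit_K Z u (affine_point z)
      = (\<lambda>p. moment R (affine_point z)) ` orbit_K Z u (affine_point z)"
    by (rule image_cong[OF refl])
  also have "\<dots> = {moment R (affine_point z)}" using ne by (simp only: image_constant_conv if_False)
  finally have "moment R ` orbit_K Z u (affine_point z) = {moment R (affine_point z)}" .
  then have "moment_P u lam R (reduced_point Z u z) = inv_into UNIV (iota u lam) (moment R (affine_point z))"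
    by (simp add: moment_P_def reduced_point_def)
  moreover have "moment R (affine_point z) \<in> range (iota u lam)"
    using level by (intro range_iota[OF span]) (simp add: level_set_def moment_K_def)
  ultimately show ?thesis by (simp add: f_inv_into_f)
qed

text \<open>The coefficients \<open>R x\<^sub>j + \<lambda>\<^sub>j = \<eta>(u\<^sub>j)\<close> pair with \<open>\<xi>\<close> to \<open>\<eta>(A \<xi>) = 0\<close>.\<close>
lemma level_set_annihilates_lie_K:
  assumes "affine_point z \<in> level_set u lam R" and "\<xi> \<in> lie_K u"
  shows "(\<Sum>j\<in>UNIV. (R * moment_coord j z + lam j) * \<xi> $ j) = 0"
proof -
  have "moment R (affine_point z) \<xi> = - lam_vec lam \<xi>"
    using assms by (simp add: level_set_def moment_K_def nu_def dual_B_eq_iff blinfun.minus_left)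
  then show ?thesis
    by (simp add: moment_affine_point lam_vec_apply sum.distrib sum_distrib_left algebra_simps)
qed


section \<open>The potential\<close>

lemma has_derivative_ln_cmod:
  assumes "z \<noteq> 0"
  shows "((\<lambda>z. ln ((cmod z)\<^sup>2)) has_derivative (\<lambda>b. 2 * Re (b / z))) (at z)"
proof -
  have "((\<lambda>z. ln (z \<bullet> z)) has_derivative (\<lambda>b. 2 * (z \<bullet> b) / (z \<bullet> z))) (at z)"
    using assms by (auto intro!: derivative_eq_intros simp: inner_commute field_simps)
  moreover have "2 * (z \<bullet> b) / (z \<bullet> z) = 2 * Re (b / z)" for b
    using assms by (simp add: cmod_power2_mult_Re_divide[symmetric] power2_norm_eq_inner[symmetric])
  ultimately show ?thesis by (simp add: power2_norm_eq_inner)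
qed

text \<open>Put \<open>D = 1 + \<parallel>z\<parallel>\<^sup>2\<close>. As \<open>\<eta>(u\<^sub>j) - \<lambda>\<^sub>j\<close> is \<open>R \<bar>z\<^sub>j\<bar>\<^sup>2 / D\<close> on the level set and the last argument of the
  logarithm is \<open>R / D\<close>, the coefficient \<open>\<Sum> \<lambda>\<^sub>j\<close> of \<open>log D\<close> cancels and only \<open>R\<close> remains. This is
  where the coefficient \<open>R + \<Sum> \<lambda>\<^sub>j\<close> in the potential comes from.\<close>
lemma potential_in_homogeneous_coordinates:
  fixes z :: "complex ^ 'n::finite"
  assumes R: "R > 0" and z: "\<And>j. z $ j \<noteq> 0"
  shows "(\<Sum>j\<in>UNIV. lam j * ln (R * moment_coord j z))
      - (R + (\<Sum>j\<in>UNIV. lam j)) * ln (R - (\<Sum>j\<in>UNIV. R * moment_coord j z))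
    = (\<Sum>j\<in>UNIV. lam j * ln ((cmod (z $ j))\<^sup>2))
      + R * ln (1 + (\<Sum>j\<in>UNIV. (cmod (z $ j))\<^sup>2)) - R * ln R"
proof -
  define D where "D = 1 + (\<Sum>k\<in>UNIV. (cmod (z $ k))\<^sup>2)"
  have D: "D > 0" unfolding D_def by (simp add: add_pos_nonneg sum_nonneg)
  have 1: "ln (R * moment_coord j z) = ln R + ln ((cmod (z $ j))\<^sup>2) - ln D" for j
    using R D z[of j] by (simp add: moment_coord_def D_def[symmetric] ln_mult ln_div)
  have 2: "R - (\<Sum>j\<in>UNIV. R * moment_coord j z) = R / D"
  proof -
    have "(\<Sum>j\<in>UNIV. R * moment_coord j z) = R * (D - 1) / D"
      unfolding moment_coord_def D_def[symmetric]
      by (simp add: D_def sum_divide_distrib sum_distrib_left)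
    then show ?thesis using D by (simp add: field_simps)
  qed
  have 3: "ln (R / D) = ln R - ln D" using R D by (simp add: ln_div)
  show ?thesis
    unfolding 1 2 3
    by (simp add: D_def[symmetric] algebra_simps sum.distrib sum_subtractf sum_distrib_left)
qed

theorem theorem5p3:
  fixes Z :: "'g::euclidean_space set"
    and u :: "'n::finite \<Rightarrow> 'g"
    and lam :: "'n \<Rightarrow> real"
    and R :: real
    and U :: "(complex ^ 'd::finite) set"
    and s :: "complex ^ 'd \<Rightarrow> complex ^ 'n"
  assumes "full_lattice Z"
    and "\<forall>j. primitive_vector Z (u j)"
    and "span (range u) = UNIV"
    and "interior (polytope_P u lam) \<noteq> {}"
    and "minimal_inequalities u lam"
    and "compact (polytope_P u lam)"
    and "R > 0"
    and "iota u lam ` polytope_P u lam \<subseteq> simplex_R R"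
    and "\<forall>\<eta>\<in>interior (polytope_P u lam). R - (\<Sum>j\<in>UNIV. \<eta> (u j) - lam j) > 0"
    and "reduced_chart Z u lam R U s"
  shows "\<forall>x\<in>U. \<forall>v w.
    omega_P R s x v w =
    i_ddbar (\<lambda>y. let \<eta> = moment_P u lam R (reduced_point Z u (s y)) in
        (\<Sum>j\<in>UNIV. lam j * ln (\<eta> (u j) - lam j))
        - (R + (\<Sum>j\<in>UNIV. lam j)) * ln (R - (\<Sum>j\<in>UNIV. \<eta> (u j) - lam j))) x v w"
    (is "\<forall>x\<in>U. \<forall>v w. _ = i_ddbar ?F x v w")
proof (intro ballI allI)
  fix x v w assume x: "x \<in> U"
  have u: "u j \<in> Z" "u j \<noteq> 0" for j using assms(2) by (simp_all add: primitive_vector_def)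
  have U: "open U" and smooth: "smooth_map_on U s"
    and level: "\<And>y. y \<in> U \<Longrightarrow> affine_point (s y) \<in> level_set u lam R"
    and inner: "\<And>y. y \<in> U \<Longrightarrow> reduced_point Z u (s y) \<in> reduced_interior Z u lam R"
    and holo: "\<And>y b. y \<in> U \<Longrightarrow> \<exists>h\<in>horizontal u R (s y).
        frechet_derivative s (at y) b - h \<in> orbit_tangent u (s y) \<and>
        frechet_derivative s (at y) (\<i> *s b) - \<i> *s h \<in> orbit_tangent u (s y)"
    using assms(10) by (auto simp: reduced_chart_def)
  define T where "T y = frechet_derivative s (at y)" for y
  have "diff_order_on (Suc 0) U s" using smooth by (simp only: smooth_map_on_def)
  then have T: "(s has_derivative T y) (at y)" if "y \<in> U" for y
    using that by (simp add: T_def frechet_derivative_works)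
  obtain H where H: "\<And>b. ((\<lambda>y. T y b) has_derivative (\<lambda>a. H a b)) (at x)" and
    H_sym: "\<And>a b. H a b = H b a"
    using smooth_second_derivative[OF smooth U x] unfolding T_def by metis
  have eta: "moment_P u lam R (reduced_point Z u (s y)) (u j) - lam j = R * moment_coord j (s y)"
    if "y \<in> U" for y j
  proof -
    have "(\<Sum>k\<in>UNIV. moment_coord k (s y) * (axis j 1 :: real ^ 'n) $ k)
        = (\<Sum>k\<in>UNIV. if k = j then moment_coord k (s y) else 0)"
      by (rule sum.cong) (auto simp: axis_def)
    then show ?thesis
      using iota_axis[of u lam "moment_P u lam R (reduced_point Z u (s y))" j]
      unfolding iota_moment_P[of Z u, OF assms(1) u(1) assms(3) level[OF that]] moment_affine_point
      by simp
  qed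
  have nz: "s y $ j \<noteq> 0" if y: "y \<in> U" for y j
  proof -
    have "moment_P u lam R (reduced_point Z u (s y)) (u j) > lam j"
      using inner[OF y] by (intro interior_polytope_P_strict u) (simp add: reduced_interior_def)
    then have "R * moment_coord j (s y) \<noteq> 0" using eta[OF y, of j] by linarith
    then show ?thesis by (auto simp: moment_coord_def)
  qed
  \<comment> \<open>\<open>E j\<close> is \<open>\<eta>(u\<^sub>j)\<close>, and \<open>\<beta> j\<close> is the pullback of \<open>dz\<^sub>j / z\<^sub>j = d\<rho>\<^sub>j + \<i> d\<theta>\<^sub>j\<close> under the lift.\<close>
  define E where "E j y = R * moment_coord j (s y) + lam j" for j y
  define \<beta> where "\<beta> j y b = T y b $ j / s y $ j" for j y b
  have F: "(?F has_derivative (\<lambda>b. 2 * (\<Sum>j\<in>UNIV. E j y * Re (\<beta> j y b)))) (at y)" if y: "y \<in> U" for y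
  proof (rule has_derivative_transform_within_open[OF _ U y])
    have d1: "((\<lambda>y. ln ((cmod (s y $ j))\<^sup>2)) has_derivative (\<lambda>b. 2 * Re (\<beta> j y b))) (at y)" for j
      unfolding \<beta>_def
      by (rule has_derivative_compose[OF bounded_linear.has_derivative[OF bounded_linear_vec_nth T[OF y]]
            has_derivative_ln_cmod[OF nz[OF y]]])
    have d2: "((\<lambda>y. ln (1 + (\<Sum>j\<in>UNIV. (cmod (s y $ j))\<^sup>2))) has_derivative
        (\<lambda>b. 2 * (\<Sum>j\<in>UNIV. moment_coord j (s y) * Re (\<beta> j y b)))) (at y)"
      unfolding \<beta>_def by (rule has_derivative_compose[OF T[OF y] has_derivative_ln_one_plus_norm])
    have "((\<lambda>y. (\<Sum>j\<in>UNIV. lam j * ln ((cmod (s y $ j))\<^sup>2))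
        + R * ln (1 + (\<Sum>j\<in>UNIV. (cmod (s y $ j))\<^sup>2)) - R * ln R) has_derivative
        (\<lambda>b. (\<Sum>j\<in>UNIV. lam j * (2 * Re (\<beta> j y b)))
          + R * (2 * (\<Sum>j\<in>UNIV. moment_coord j (s y) * Re (\<beta> j y b))) - 0)) (at y)"
      by (intro has_derivative_diff has_derivative_add has_derivative_sum has_derivative_mult_right
          d1 d2 has_derivative_const)
    also have "(\<lambda>b. (\<Sum>j\<in>UNIV. lam j * (2 * Re (\<beta> j y b)))
          + R * (2 * (\<Sum>j\<in>UNIV. moment_coord j (s y) * Re (\<beta> j y b))) - 0)
        = (\<lambda>b. 2 * (\<Sum>j\<in>UNIV. E j y * Re (\<beta> j y b)))"
      by (simp add: E_def fun_eq_iff sum_distrib_left sum.distrib algebra_simps)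
    finally show "((\<lambda>y. (\<Sum>j\<in>UNIV. lam j * ln ((cmod (s y $ j))\<^sup>2))
        + R * ln (1 + (\<Sum>j\<in>UNIV. (cmod (s y $ j))\<^sup>2)) - R * ln R) has_derivative
        (\<lambda>b. 2 * (\<Sum>j\<in>UNIV. E j y * Re (\<beta> j y b)))) (at y)" .
  qed (simp only: Let_def eta potential_in_homogeneous_coordinates[OF \<open>R > 0\<close> nz])
  \<comment> \<open>The lift is holomorphic up to orbit directions, and \<open>\<eta> \<circ> A\<close> vanishes on the Lie algebra of \<open>K\<close>.\<close>
  have rot: "(\<Sum>j\<in>UNIV. E j y * Re (\<beta> j y (\<i> *s b))) = - (\<Sum>j\<in>UNIV. E j y * Im (\<beta> j y b))"
    if y: "y \<in> U" for y b
  proof -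
    obtain h \<xi> \<xi>' where \<xi>: "\<xi> \<in> lie_K u" and
      h: "T y b - h = (\<chi> j. 2 * complex_of_real pi * \<i> * complex_of_real (\<xi> $ j) * s y $ j)" and
      ih: "T y (\<i> *s b) - \<i> *s h = (\<chi> j. 2 * complex_of_real pi * \<i> * complex_of_real (\<xi>' $ j) * s y $ j)"
      using holo[OF y, of b] unfolding T_def[symmetric] orbit_tangent_def by blast
    have Re_i: "Re (\<beta> j y (\<i> *s b)) = 2 * pi * \<xi> $ j - Im (\<beta> j y b)" for j
    proof -
      have "T y b $ j = h $ j + 2 * complex_of_real pi * \<i> * complex_of_real (\<xi> $ j) * s y $ j"
        using arg_cong[OF h, of "\<lambda>t. t $ j"] by (simp add: algebra_simps)
      then have "\<beta> j y b = h $ j / s y $ j + 2 * complex_of_real pi * \<i> * complex_of_real (\<xi> $ j)"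
        using nz[OF y, of j] by (simp add: \<beta>_def add_divide_distrib)
      moreover have "T y (\<i> *s b) $ j = \<i> * h $ j + 2 * complex_of_real pi * \<i> * complex_of_real (\<xi>' $ j) * s y $ j"
        using arg_cong[OF ih, of "\<lambda>t. t $ j"] by (simp add: algebra_simps)
      then have "\<beta> j y (\<i> *s b) = \<i> * (h $ j / s y $ j) + 2 * complex_of_real pi * \<i> * complex_of_real (\<xi>' $ j)"
        using nz[OF y, of j] by (simp add: \<beta>_def add_divide_distrib)
      ultimately show ?thesis by (simp del: times_divide_eq_right)
    qed
    have "(\<Sum>j\<in>UNIV. E j y * Re (\<beta> j y (\<i> *s b))) =
        2 * pi * (\<Sum>j\<in>UNIV. E j y * \<xi> $ j) - (\<Sum>j\<in>UNIV. E j y * Im (\<beta> j y b))"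
      unfolding Re_i by (simp add: algebra_simps sum_subtractf sum_distrib_left)
    also have "(\<Sum>j\<in>UNIV. E j y * \<xi> $ j) = 0"
      unfolding E_def by (rule level_set_annihilates_lie_K[OF level[OF y] \<xi>])
    finally show ?thesis by simp
  qed
  have E: "(E j has_derivative (\<lambda>a. R * moment_coord_deriv j (s x) (T x a))) (at x)" for j
    unfolding E_def
    by (auto intro!: derivative_eq_intros has_derivative_compose[OF T[OF x] has_derivative_moment_coord])
  \<comment> \<open>Symmetric in \<open>a\<close> and \<open>b\<close>, because \<open>H\<close> is: the form \<open>\<beta> j\<close> is closed.\<close>
  have \<beta>: "((\<lambda>y. \<beta> j y b) has_derivative
      (\<lambda>a. (H a b $ j * s x $ j - T x b $ j * T x a $ j) / (s x $ j * s x $ j))) (at x)" for j b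
    unfolding \<beta>_def
    using nz[OF x]
    by (intro has_derivative_divide' bounded_linear.has_derivative[OF bounded_linear_vec_nth] H T x)
  have "i_ddbar ?F x v w = complex_of_real (\<Sum>j\<in>UNIV.
      R * moment_coord_deriv j (s x) (T x v) * Im (\<beta> j x w)
      - R * moment_coord_deriv j (s x) (T x w) * Im (\<beta> j x v))"
  proof (rule i_ddbar_polar[OF U x F rot E \<beta>])
    show "(H a b $ j * s x $ j - T x b $ j * T x a $ j) / (s x $ j * s x $ j) =
        (H b a $ j * s x $ j - T x a $ j * T x b $ j) / (s x $ j * s x $ j)" for j a b
      using H_sym[of a b] by (simp add: mult.commute)
    show "(\<Sum>j\<in>UNIV. R * moment_coord_deriv j (s x) (T x a) * Re (\<beta> j x b)) =
        (\<Sum>j\<in>UNIV. R * moment_coord_deriv j (s x) (T x b) * Re (\<beta> j x a))" for a b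
      using moment_coord_deriv_symmetric[OF nz[OF x], of "T x a" "T x b"]
      by (simp add: \<beta>_def mult.assoc sum_distrib_left[symmetric])
  qed
  also have "\<dots> = omega_P R s x v w"
    unfolding omega_P_def T_def[symmetric] fubini_study_polar[OF nz[OF x]] \<beta>_def
    by (simp add: sum_distrib_left right_diff_distrib mult.assoc)
  finally show "omega_P R s x v w = i_ddbar ?F x v w" by simp
qed

end
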